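(* For all integers $d,n\ge 0$, the map $\mathrm{mh}$ restricts to a bijection $\mathrm{mh}:\mathrm{dA}_n\to \mathrm{dMch}_n$.
   Context: $d$-ascent sequences. For a sequence $\alpha=a_1a_2\ldots a_n$ of nonnegative integers and $d\ge 0$, an index $k\in\{1,\dots,n-1\}$ is a $d$-ascent of $\alpha$ if $a_{k+1}>a_k-d$; $\mathrm{dasc}\,\alpha$ is the number of $d$-ascents of $\alpha$. Write $\alpha_k=a_1\ldots a_k$. The sequence $\alpha$ is a $d$-ascent sequence if $a_1=0$ and $a_{k+1}\le 1+\mathrm{dasc}\,\alpha_k$ for $k\in\{1,\dots,n-1\}$. $\mathrm{dA}_n$ is the set of $d$-ascent sequences of length $n$. Let $\mathrm{I}_n$ be the set of inversion sequences of length $n$, i.e. integer sequences $a_1\ldots a_n$ with $0\le a_k<k$ for all $k\in\{1,\dots,n\}$; one has $\mathrm{dA}_n\subseteq \mathrm{I}_n$. Matchings. A (perfect) matching $m$ on $[2n]=\{1,\dots,2n\}$ is a graph on this vertex set with $n$ edges, no two sharing a vertex. Edges are written $ij$ with $i<j$ and labelled $e_1=i_1j_1,\dots,e_n=i_nj_n$ so that $j_1<j_2<\dots<j_n=2n$. The active spaces of $m$ are the spaces immediately before the vertices $j_1,j_2,\dots,j_n$ together with the space after $2n$; they are labelled $0,1,\dots,n$ from left to right. (The empty matching has one active space, labelled $0$.) The map $\mathrm{mh}$ on $\mathrm{I}_n$. Given $\alpha=a_1\ldots a_n\in \mathrm{I}_n$, construct matchings $\emptyset=m_0,m_1,\dots,m_n=\mathrm{mh}(\alpha)$,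 with $m_k$ a matching on $[2k]$: to obtain $m_k$ from $m_{k-1}$, insert one new vertex in the active space labelled $a_k$ and one new vertex in the active space labelled $k-1$ of $m_{k-1}$ (both in the last space if $a_k=k-1$), join the two new vertices by an edge, and renumber the vertices $1,\dots,2k$ from left to right. Target set. A left nesting in $m$ is a pair of edges $ij$ and $kl$ with $i<k<l<j$ and $k=i+1$. $\mathrm{M}_n$ is the set of matchings on $[2n]$ with no left nestings. An edge $kl$ is to the left of an edge $e=ij$ if $l<i$, and $\mathrm{lef}(e)$ is the number of edges to the left of $e$. An index $k\in\{1,\dots,n-1\}$ is a $d$-displacement of a matching $m$ on $[2n]$ if $\mathrm{lef}(e_{k+1})>\mathrm{lef}(e_k)-d$; $\mathrm{ddis}\,m$ is the number of $d$-displacements of $m$. For a matching $m$ on $[2n]$ with edges $e_1=i_1j_1,\dots,e_n=i_nj_n$, where $i_k<j_k$ for each $k$ and the edges are labelled so that $j_1<j_2<\dots<j_n=2n$, $m_k$ also denotes the restriction of $m$ to $e_1,\dots,e_k$ (remove all vertices that are not endpoints of these edges and relabel the remaining vertices $1,\dots,2k$ in order). Then $$\mathrm{dMch}_n=\{m\in \mathrm{M}_n : \mathrm{lef}(e_{k+1})\le 1+\mathrm{ddis}(m_k)\text{ for all }k\in\{1,\dots,n-1\}\}.$$ *)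

theory Defs
  imports Main
begin

text \<open>
  A sequence \<open>a\<^sub>1 \<dots> a\<^sub>n\<close> is a list, so that \<open>a\<^sub>k\<close> is \<open>\<alpha> ! (k - 1)\<close> and the prefix \<open>a\<^sub>1 \<dots> a\<^sub>k\<close> is
  \<open>take k \<alpha>\<close>.
\<close>

definition dasc :: "nat \<Rightarrow> nat list \<Rightarrow> nat" where
  "dasc d \<alpha> = card {k \<in> {1..<length \<alpha>}. int (\<alpha> ! k) > int (\<alpha> ! (k - 1)) - int d}"

text \<open>For \<open>n = 0\<close> the condition \<open>a\<^sub>1 = 0\<close> is vacuous: the empty sequence is the only member.\<close>

definition dA :: "nat \<Rightarrow> nat \<Rightarrow> nat list set" where
  "dA d n = {\<alpha>. length \<alpha> = n \<and> (n > 0 \<longrightarrow> \<alpha> ! 0 = 0) \<and>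
                (\<forall>k \<in> {1..<n}. \<alpha> ! k \<le> 1 + dasc d (take k \<alpha>))}"

definition inversion_seqs :: "nat \<Rightarrow> nat list set" where
  "inversion_seqs n = {\<alpha>. length \<alpha> = n \<and> (\<forall>k \<in> {1..n}. \<alpha> ! (k - 1) < k)}"

lemma dasc_le: "dasc d \<alpha> \<le> length \<alpha> - 1"
proof -
  have "dasc d \<alpha> \<le> card {1..<length \<alpha>}"
    unfolding dasc_def by (rule card_mono) auto
  then show ?thesis by simp
qed

lemma dA_subset_inversion_seqs: "dA d n \<subseteq> inversion_seqs n"
proof
  fix \<alpha> assume \<alpha>: "\<alpha> \<in> dA d n"
  have "\<alpha> ! (k - 1) < k" if k: "k \<in> {1..n}" for k
  proof (cases "k = 1")
    case True
    then show ?thesis using \<alpha> k by (auto simp: dA_def)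
  next
    case False
    then have "k - 1 \<in> {1..<n}" using k by auto
    then have "\<alpha> ! (k - 1) \<le> 1 + dasc d (take (k - 1) \<alpha>)"
      using \<alpha> unfolding dA_def by blast
    moreover have "dasc d (take (k - 1) \<alpha>) \<le> k - 1 - 1"
      using dasc_le[of d "take (k - 1) \<alpha>"] by simp
    ultimately show ?thesis using False k by auto
  qed
  then show "\<alpha> \<in> inversion_seqs n"
    using \<alpha> by (auto simp: dA_def inversion_seqs_def)
qed

text \<open>An edge \<open>ij\<close> with \<open>i < j\<close> is the pair \<open>(i, j)\<close>; a matching is its set of edges.\<close>

type_synonym edge = "nat \<times> nat"

definition matchings :: "nat \<Rightarrow> edge set set" where
  "matchings n = {m. (\<forall>(i, j) \<in> m. 1 \<le> i \<and> i < j \<and> j \<le> 2 * n) \<and> card m = n \<and>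
                     (\<forall>e \<in> m. \<forall>f \<in> m. e \<noteq> f \<longrightarrow> {fst e, snd e} \<inter> {fst f, snd f} = {})}"

text \<open>
  \<open>closer m k\<close> is \<open>j\<^sub>k\<close> and \<open>nth_edge m k\<close> is \<open>e\<^sub>k\<close>, for \<open>1 \<le> k \<le> card m\<close>.
\<close>

definition closer :: "edge set \<Rightarrow> nat \<Rightarrow> nat" where
  "closer m k = sorted_list_of_set (snd ` m) ! (k - 1)"

definition nth_edge :: "edge set \<Rightarrow> nat \<Rightarrow> edge" where
  "nth_edge m k = (THE e. e \<in> m \<and> snd e = closer m k)"

definition left_nesting :: "edge set \<Rightarrow> edge \<Rightarrow> edge \<Rightarrow> bool" where
  "left_nesting m e f \<longleftrightarrow> e \<in> m \<and> f \<in> m \<and>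
     fst e < fst f \<and> fst f < snd f \<and> snd f < snd e \<and> fst f = fst e + 1"

definition no_left_nestings :: "nat \<Rightarrow> edge set set" where
  "no_left_nestings n = {m \<in> matchings n. \<not> (\<exists>e f. left_nesting m e f)}"

text \<open>
  A space is encoded by the number of vertices to its left, so space \<open>p\<close> lies between the vertices
  \<open>p\<close> and \<open>p + 1\<close>. The active space labelled \<open>r\<close> precedes \<open>j\<^bsub>r+1\<^esub>\<close>, or is the last space if
  \<open>r = card m\<close>.
\<close>

definition active_space :: "edge set \<Rightarrow> nat \<Rightarrow> nat" where
  "active_space m r = (if r < card m then closer m (r + 1) - 1 else 2 * card m)"

text \<open>
  Insert one new vertex in space \<open>p\<close> and one in space \<open>q\<close>, where \<open>p \<le> q\<close>, joined by an edge. An old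
  vertex moves right by the number of new vertices inserted before it.
\<close>

definition insert_edge :: "nat \<Rightarrow> nat \<Rightarrow> edge set \<Rightarrow> edge set" where
  "insert_edge p q m =
     (let shift = (\<lambda>v. v + (if p < v then 1 else 0) + (if q < v then 1 else 0))
      in insert (p + 1, q + 2) (map_prod shift shift ` m))"

primrec mh_step :: "nat list \<Rightarrow> nat \<Rightarrow> edge set" where
  "mh_step \<alpha> 0 = {}"
| "mh_step \<alpha> (Suc k) =
     (let m = mh_step \<alpha> k in insert_edge (active_space m (\<alpha> ! k)) (active_space m k) m)"

definition mh :: "nat list \<Rightarrow> edge set" where
  "mh \<alpha> = mh_step \<alpha> (length \<alpha>)"

definition lef :: "edge set \<Rightarrow> edge \<Rightarrow> nat" where
  "lef m e = card {f \<in> m. snd f < fst e}"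

definition ddis :: "nat \<Rightarrow> edge set \<Rightarrow> nat" where
  "ddis d m = card {k \<in> {1..<card m}.
     int (lef m (nth_edge m (k + 1))) > int (lef m (nth_edge m k)) - int d}"

text \<open>Relabel the endpoints order-preservingly as \<open>1, 2, \<dots>\<close>.\<close>

definition standardize :: "edge set \<Rightarrow> edge set" where
  "standardize m =
     (let V = fst ` m \<union> snd ` m; rank = (\<lambda>v. card {w \<in> V. w \<le> v})
      in map_prod rank rank ` m)"

definition restr :: "edge set \<Rightarrow> nat \<Rightarrow> edge set" where
  "restr m k = standardize (nth_edge m ` {1..k})"

definition dMch :: "nat \<Rightarrow> nat \<Rightarrow> edge set set" where
  "dMch d n = {m \<in> no_left_nestings n.
     \<forall>k \<in> {1..<n}. lef m (nth_edge m (k + 1)) \<le> 1 + ddis d (restr m k)}"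

end

theory Submission
  imports Defs
begin

text \<open>
  The edge added at the \<open>k\<close>-th step of \<open>mh\<close> closes after all the others, and its opener goes into
  the active space labelled \<open>a\<^sub>k\<close>, which has exactly \<open>a\<^sub>k\<close> closers to its left. Later insertions
  preserve the relative order of the old vertices. Hence \<open>lef\<close> of the \<open>k\<close>-th edge of \<open>mh \<alpha>\<close> is
  \<open>a\<^sub>k\<close> (lemma \<open>lef_nth_edge_mh\<close>), which makes \<open>mh\<close> injective, and the restriction of \<open>mh \<alpha>\<close> to
  its first \<open>k\<close> edges is \<open>mh\<close> of the prefix of length \<open>k\<close> (lemma \<open>restr_mh\<close>), which makes
  \<open>d\<close>-displacements the same thing as \<open>d\<close>-ascents.

  The image of the inversion sequences is the set of matchings without left nestings. The vertex
  after the new opener is a closer, possibly its own, and the new edge closes last; so the new edge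
  is neither the outer nor the inner edge of a left nesting (lemma \<open>add_edge_no_left_nestings\<close>).
  Conversely, let \<open>i\<close> be the opener of the last edge of a matching without left nestings. If \<open>i + 1\<close> were an opener, its edge would be left nested in the last edge;
  so \<open>i + 1\<close> is a closer, that is, \<open>i\<close> sits in an active space of the matching left after the last
  edge is deleted, and that smaller matching again has no left nestings
  (lemma \<open>no_left_nestings_SucE\<close>).

  Under this bijection the inequalities defining \<open>dA\<close> and \<open>dMch\<close> are literally the same.
\<close>

section \<open>Order-preserving relabelling\<close>

lemma sorted_list_of_set_image:
  fixes f :: "nat \<Rightarrow> nat"
  assumes "finite A" "strict_mono f"
  shows "sorted_list_of_set (f ` A) = map f (sorted_list_of_set A)"
proof -
  have inj: "inj_on f A"
    using assms(2) strict_mono_eq by (auto simp: inj_on_def)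
  have "sorted_wrt (<) (map f (sorted_list_of_set A))"
    using strict_sorted_list_of_set[of A] assms(2)
    by (auto simp: sorted_wrt_map strict_mono_less)
  then show ?thesis
    using assms inj
      sorted_list_of_set_unique[of "f ` A" "map f (sorted_list_of_set A)"]
    by (auto simp: card_image)
qed

lemma sorted_list_of_set_insert_greatest:
  fixes x :: nat
  assumes "finite A" "\<And>y. y \<in> A \<Longrightarrow> y < x"
  shows "sorted_list_of_set (insert x A) = sorted_list_of_set A @ [x]"
proof -
  have "x \<notin> A" using assms(2) by blast
  moreover have "sorted_wrt (<) (sorted_list_of_set A @ [x])"
    using strict_sorted_list_of_set[of A] assms by (auto simp: sorted_wrt_append)
  ultimately show ?thesis
    using assms(1) sorted_list_of_set_unique[of "insert x A" "sorted_list_of_set A @ [x]"]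
    by auto
qed

lemma card_less_nth_sorted_list_of_set:
  fixes A :: "nat set"
  assumes "finite A" "r < card A"
  shows "card {y \<in> A. y < sorted_list_of_set A ! r} = r"
proof -
  define xs where "xs = sorted_list_of_set A"
  have s: "sorted_wrt (<) xs" and l: "length xs = card A" and st: "set xs = A"
    using assms strict_sorted_list_of_set[of A] by (auto simp: xs_def)
  have lt: "xs ! i < xs ! j \<longleftrightarrow> i < j" if "i < length xs" "j < length xs" for i j
    using s that sorted_wrt_nth_less[OF s, of i j] sorted_wrt_nth_less[OF s, of j i]
    by (metis less_asym linorder_neqE_nat)
  have mem: "y \<in> A \<longleftrightarrow> (\<exists>i<length xs. y = xs ! i)" for y
    using in_set_conv_nth[of y xs] by (auto simp: st)
  have "{y \<in> A. y < xs ! r} = (\<lambda>i. xs ! i) ` {..<r}"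
  proof (intro set_eqI iffI)
    fix y assume "y \<in> {y \<in> A. y < xs ! r}"
    then show "y \<in> (\<lambda>i. xs ! i) ` {..<r}" using lt assms(2) l by (auto simp: mem)
  next
    fix y assume "y \<in> (\<lambda>i. xs ! i) ` {..<r}"
    then obtain i where i: "i < r" "y = xs ! i" by blast
    then have "y \<in> A" using assms(2) l nth_mem[of i xs] by (simp add: st)
    then show "y \<in> {y \<in> A. y < xs ! r}" using i lt[of i r] assms(2) l by simp
  qed
  moreover have "inj_on (\<lambda>i. xs ! i) {..<r}"
    using lt assms(2) l by (intro inj_onI) (metis lessThan_iff less_trans linorder_neqE_nat less_irrefl)
  ultimately show ?thesis by (simp add: card_image xs_def)
qed

lemma closer_mem:
  assumes "finite m" "inj_on snd m" "k \<in> {1..card m}"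
  shows "closer m k \<in> snd ` m"
proof -
  have "k - 1 < length (sorted_list_of_set (snd ` m))"
    using assms by (auto simp: card_image)
  then have "sorted_list_of_set (snd ` m) ! (k - 1) \<in> set (sorted_list_of_set (snd ` m))"
    by (rule nth_mem)
  then show ?thesis using assms(1) by (simp add: closer_def)
qed

lemma nth_edge_eqI:
  assumes "inj_on snd m" "e \<in> m" "snd e = closer m k"
  shows "nth_edge m k = e"
  unfolding nth_edge_def using assms by (intro the_equality) (auto simp: inj_on_def)

lemma nth_edge_mem:
  assumes "finite m" "inj_on snd m" "k \<in> {1..card m}"
  shows "nth_edge m k \<in> m" and "snd (nth_edge m k) = closer m k"
proof -
  obtain e where "e \<in> m" "snd e = closer m k"
    using closer_mem[OF assms] by (metis imageE)
  with nth_edge_eqI[OF assms(2) this] show "nth_edge m k \<in> m" "snd (nth_edge m k) = closer m k"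
    by simp_all
qed

lemma inj_map_prod_strict_mono:
  fixes f :: "nat \<Rightarrow> nat"
  assumes "strict_mono f"
  shows "inj (map_prod f f)"
  using assms by (auto simp: inj_on_def strict_mono_eq)

lemma inj_on_snd_map_prod_strict_mono:
  fixes f :: "nat \<Rightarrow> nat"
  assumes "strict_mono f" "inj_on snd m"
  shows "inj_on snd (map_prod f f ` m)"
  using assms by (fastforce simp: inj_on_def strict_mono_eq)

lemma nth_edge_map_prod:
  assumes "finite m" "inj_on snd m" "strict_mono f" "k \<in> {1..card m}"
  shows "nth_edge (map_prod f f ` m) k = map_prod f f (nth_edge m k)"
proof (rule nth_edge_eqI)
  have "snd ` map_prod f f ` m = f ` snd ` m" by force
  moreover have "k - 1 < length (sorted_list_of_set (snd ` m))"
    using assms by (auto simp: card_image)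
  ultimately have "closer (map_prod f f ` m) k = f (closer m k)"
    using assms(1,3) by (simp add: closer_def sorted_list_of_set_image)
  then show "snd (map_prod f f (nth_edge m k)) = closer (map_prod f f ` m) k"
    using nth_edge_mem[OF assms(1,2,4)] by simp
qed (use assms nth_edge_mem[OF assms(1,2,4)] in \<open>auto intro: inj_on_snd_map_prod_strict_mono\<close>)

lemma lef_map_prod:
  fixes f :: "nat \<Rightarrow> nat"
  assumes "strict_mono f"
  shows "lef (map_prod f f ` m) (map_prod f f e) = lef m e"
proof -
  have "{g \<in> map_prod f f ` m. snd g < fst (map_prod f f e)} = map_prod f f ` {g \<in> m. snd g < fst e}"
    using assms by (auto simp: strict_mono_less)
  then show ?thesis
    unfolding lef_def
    using card_image[OF inj_on_subset[OF inj_map_prod_strict_mono[OF assms] subset_UNIV]] by simp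
qed

text \<open>
  A rank depends only on the relative order of the vertices, so standardizing forgets any strictly
  increasing relabelling. This is what lets restrictions ignore later insertions.
\<close>

lemma standardize_map_prod:
  assumes "strict_mono f"
  shows "standardize (map_prod f f ` m) = standardize m"
proof -
  let ?V = "fst ` m \<union> snd ` m"
  have V: "fst ` map_prod f f ` m \<union> snd ` map_prod f f ` m = f ` ?V" by force
  have rank: "card {w \<in> f ` ?V. w \<le> f v} = card {w \<in> ?V. w \<le> v}" for v
  proof -
    have "{w \<in> f ` ?V. w \<le> f v} = f ` {w \<in> ?V. w \<le> v}"
      using assms by (auto simp: strict_mono_less_eq)
    moreover have "inj_on f {w \<in> ?V. w \<le> v}"
      using assms by (auto simp: inj_on_def strict_mono_eq)
    ultimately show ?thesis by (simp add: card_image)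
  qed
  show ?thesis
    unfolding standardize_def Let_def V
    by (simp only: image_comp comp_def map_prod_def case_prod_unfold fst_conv snd_conv rank)
qed

section \<open>An edge that closes last\<close>

lemma sorted_closers_insert:
  fixes m :: "edge set"
  assumes "finite m" "\<And>e. e \<in> m \<Longrightarrow> snd e < j"
  shows "sorted_list_of_set (snd ` insert (i, j) m) = sorted_list_of_set (snd ` m) @ [j]"
  using assms sorted_list_of_set_insert_greatest[of "snd ` m" j] by (simp only: image_insert snd_conv) blast

lemma inj_on_snd_insert:
  fixes m :: "edge set"
  assumes "inj_on snd m" "\<And>e. e \<in> m \<Longrightarrow> snd e < j"
  shows "inj_on snd (insert (i, j) m)"
proof -
  have "j \<notin> snd ` m" using assms(2) by blast
  then show ?thesis using assms(1) by auto
qed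

lemma nth_edge_insert_old:
  assumes "finite m" "inj_on snd m" "\<And>e. e \<in> m \<Longrightarrow> snd e < j" "k \<in> {1..card m}"
  shows "nth_edge (insert (i, j) m) k = nth_edge m k"
proof (rule nth_edge_eqI)
  have sorted: "sorted_list_of_set (snd ` insert (i, j) m) = sorted_list_of_set (snd ` m) @ [j]"
    using assms by (intro sorted_closers_insert)
  have "closer (insert (i, j) m) k = closer m k"
    unfolding closer_def unfolding sorted
    using assms(2,4) by (auto simp: nth_append card_image)
  then show "snd (nth_edge m k) = closer (insert (i, j) m) k"
    using nth_edge_mem[OF assms(1,2,4)] by simp
  show "inj_on snd (insert (i, j) m)" using assms(2,3) by (intro inj_on_snd_insert)
qed (use nth_edge_mem[OF assms(1,2,4)] in auto)

lemma nth_edge_insert_new: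
  assumes "finite m" "inj_on snd m" "\<And>e. e \<in> m \<Longrightarrow> snd e < j"
  shows "nth_edge (insert (i, j) m) (card m + 1) = (i, j)"
proof (rule nth_edge_eqI)
  have sorted: "sorted_list_of_set (snd ` insert (i, j) m) = sorted_list_of_set (snd ` m) @ [j]"
    using assms by (intro sorted_closers_insert)
  show "snd (i, j) = closer (insert (i, j) m) (card m + 1)"
    unfolding closer_def unfolding sorted
    using assms(2) by (simp add: nth_append card_image)
  show "inj_on snd (insert (i, j) m)" using assms(2,3) by (intro inj_on_snd_insert)
qed auto

text \<open>An edge that does not close before \<open>e\<close> opens is not counted by \<open>lef\<close>.\<close>

lemma lef_insert:
  assumes "fst e \<le> j"
  shows "lef (insert (i, j) m) e = lef m e"
  using assms unfolding lef_def by (intro arg_cong[of _ _ card]) auto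

section \<open>Matchings\<close>

lemma matchingsD:
  assumes "m \<in> matchings n"
  shows "finite m" "card m = n" "inj_on snd m" "inj_on fst m"
    and "\<And>e. e \<in> m \<Longrightarrow> 1 \<le> fst e \<and> fst e < snd e \<and> snd e \<le> 2 * n"
    and "\<And>e f. e \<in> m \<Longrightarrow> f \<in> m \<Longrightarrow> fst e \<noteq> snd f"
proof -
  show b: "\<And>e. e \<in> m \<Longrightarrow> 1 \<le> fst e \<and> fst e < snd e \<and> snd e \<le> 2 * n"
    using assms by (auto simp: matchings_def)
  have "m \<subseteq> {..2 * n} \<times> {..2 * n}" using b by fastforce
  then show "finite m" by (rule finite_subset) auto
  show "card m = n" using assms by (auto simp: matchings_def)
  have d: "e = f" if "e \<in> m" "f \<in> m" "{fst e, snd e} \<inter> {fst f, snd f} \<noteq> {}" for e f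
    using assms that unfolding matchings_def by blast
  show "inj_on snd m" by (rule inj_onI, rule d) auto
  show "inj_on fst m" by (rule inj_onI, rule d) auto
  show "fst e \<noteq> snd f" if "e \<in> m" "f \<in> m" for e f
    using d[OF that] b[OF that(1)] by auto
qed

lemma matchingsI:
  assumes "card m = n" "inj_on snd m" "inj_on fst m"
    and "\<And>e. e \<in> m \<Longrightarrow> 1 \<le> fst e \<and> fst e < snd e \<and> snd e \<le> 2 * n"
    and "\<And>e f. e \<in> m \<Longrightarrow> f \<in> m \<Longrightarrow> fst e \<noteq> snd f"
  shows "m \<in> matchings n"
proof -
  have "{fst e, snd e} \<inter> {fst f, snd f} = {}" if "e \<in> m" "f \<in> m" "e \<noteq> f" for e f
    using that assms(5)[of e f] assms(5)[of f e] inj_onD[OF assms(2), of e f]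
      inj_onD[OF assms(3), of e f] by auto
  then show ?thesis using assms(1,4) 
    unfolding matchings_def mem_Collect_eq case_prod_unfold by blast
qed

lemma vertices_matching:
  assumes "m \<in> matchings n"
  shows "fst ` m \<union> snd ` m = {1..2 * n}"
proof (rule card_subset_eq)
  note M = matchingsD[OF assms]
  show "fst ` m \<union> snd ` m \<subseteq> {1..2 * n}" using M(5) by fastforce
  have "fst ` m \<inter> snd ` m = {}" using M(6) by blast
  then show "card (fst ` m \<union> snd ` m) = card {1..2 * n}"
    using M by (simp add: card_Un_disjoint card_image)
qed simp

lemma nth_edge_image_all:
  assumes "m \<in> matchings n"
  shows "nth_edge m ` {1..n} = m"
proof
  note M = matchingsD[OF assms]
  show "nth_edge m ` {1..n} \<subseteq> m" using nth_edge_mem(1)[OF M(1,3)] M(2) by auto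
  show "m \<subseteq> nth_edge m ` {1..n}"
  proof
    fix e assume e: "e \<in> m"
    then have "snd e \<in> set (sorted_list_of_set (snd ` m))" using M(1) by simp
    then obtain r where r: "r < length (sorted_list_of_set (snd ` m))"
        "sorted_list_of_set (snd ` m) ! r = snd e"
      by (auto simp: in_set_conv_nth)
    then have "nth_edge m (r + 1) = e" using e M(3) by (intro nth_edge_eqI) (auto simp: closer_def)
    moreover have "r + 1 \<in> {1..n}" using r M by (simp add: card_image)
    ultimately show "e \<in> nth_edge m ` {1..n}" by blast
  qed
qed

text \<open>The vertices of a matching are exactly \<open>1, \<dots>, 2n\<close>, so each vertex is its own rank.\<close>

lemma restr_all:
  assumes "m \<in> matchings n"
  shows "restr m n = m"
proof -
  note M = matchingsD[OF assms]
  have "card {w \<in> {1..2 * n}. w \<le> v} = v" if "v \<le> 2 * n" for v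
  proof -
    have "{w \<in> {1..2 * n}. w \<le> v} = {1..v}" using that by auto
    then show ?thesis by simp
  qed
  moreover have "fst e \<le> 2 * n \<and> snd e \<le> 2 * n" if "e \<in> m" for e
    using M(5)[OF that] by auto
  ultimately have "map_prod (\<lambda>v. card {w \<in> {1..2 * n}. w \<le> v}) (\<lambda>v. card {w \<in> {1..2 * n}. w \<le> v}) e = e"
    if "e \<in> m" for e
    using that by (cases e) auto
  then show ?thesis
    unfolding restr_def nth_edge_image_all[OF assms] standardize_def Let_def vertices_matching[OF assms]
    by simp
qed

section \<open>Adding an edge that closes last\<close>

definition add_edge :: "nat \<Rightarrow> edge set \<Rightarrow> edge set" where
  "add_edge a m = insert_edge (active_space m a) (active_space m (card m)) m"

definition shift :: "nat \<Rightarrow> nat \<Rightarrow> nat \<Rightarrow> nat" where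
  "shift p q v = v + (if p < v then 1 else 0) + (if q < v then 1 else 0)"

lemma strict_mono_shift: "strict_mono (shift p q)"
  by (rule strict_monoI) (auto simp: shift_def)

lemma insert_edge_shift:
  "insert_edge p q m = insert (p + 1, q + 2) (map_prod (shift p q) (shift p q) ` m)"
  by (simp add: insert_edge_def shift_def[abs_def] Let_def)

lemma add_edge_shift:
  "add_edge a m = insert (active_space m a + 1, 2 * card m + 2)
     (map_prod (shift (active_space m a) (2 * card m)) (shift (active_space m a) (2 * card m)) ` m)"
  by (simp add: add_edge_def insert_edge_shift active_space_def)

lemma active_space_le:
  assumes "m \<in> matchings n" "a \<le> n"
  shows "active_space m a \<le> 2 * n"
  using assms closer_mem[of m "a + 1"] matchingsD[OF assms(1)]
  by (fastforce simp: active_space_def)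

text \<open>
  The space labelled \<open>a\<close> precedes the \<open>(a + 1)\<close>-st closer, so exactly the first \<open>a\<close> closers are to
  its left. For \<open>a = n\<close> it is the space after all vertices.
\<close>

lemma card_closers_before_active_space:
  assumes "m \<in> matchings n" "a \<le> n"
  shows "card {f \<in> m. snd f \<le> active_space m a} = a"
proof (cases "a < n")
  case True
  note M = matchingsD[OF assms(1)]
  have "closer m (a + 1) \<in> snd ` m" using closer_mem M(1-3) True by auto
  then have pos: "closer m (a + 1) \<ge> 1" using M(5) by fastforce
  have "snd ` {f \<in> m. snd f \<le> active_space m a} = {y \<in> snd ` m. y < closer m (a + 1)}"
    using True M(2) pos by (auto simp: active_space_def)
  moreover have "card \<dots> = a"
    unfolding closer_def using card_less_nth_sorted_list_of_set[of "snd ` m" a] M True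
    by (simp add: card_image)
  moreover have "inj_on snd {f \<in> m. snd f \<le> active_space m a}"
    using M(3) by (rule inj_on_subset) auto
  ultimately show ?thesis using card_image[of snd "{f \<in> m. snd f \<le> active_space m a}"] by simp
next
  case False
  note M = matchingsD[OF assms(1)]
  have "{f \<in> m. snd f \<le> active_space m a} = m"
    using False M(2,5) by (auto simp: active_space_def)
  then show ?thesis using False assms(2) M(2) by simp
qed

text \<open>
  Below, \<open>p\<close> is the space that receives the new opener and \<open>s\<close> tells where the old vertices go.
\<close>

context
  fixes m n a p s
  assumes m: "m \<in> matchings n" and a: "a \<le> n"
    and p_def: "p = active_space m a" and s_def: "s = shift p (2 * n)"
begin

lemma add_edge_eq: "add_edge a m = insert (p + 1, 2 * n + 2) (map_prod s s ` m)"
  using matchingsD(2)[OF m] by (simp add: add_edge_shift p_def s_def)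

lemma opener_space_le: "p \<le> 2 * n"
  using active_space_le[OF m a] p_def by simp

lemma strict_mono_relabelling: "strict_mono s"
  by (simp add: s_def strict_mono_shift)

lemma relabel_old_vertex: "v \<le> 2 * n \<Longrightarrow> s v = (if p < v then v + 1 else v)"
  by (simp add: s_def shift_def)

lemma relabelled_edge_bounds: "e \<in> map_prod s s ` m \<Longrightarrow> 1 \<le> fst e \<and> fst e < snd e \<and> snd e \<le> 2 * n + 1"
proof -
  assume "e \<in> map_prod s s ` m"
  then obtain f where f: "f \<in> m" "e = map_prod s s f" by auto
  then show ?thesis
    using matchingsD(5)[OF m f(1)] relabel_old_vertex[of "fst f"] relabel_old_vertex[of "snd f"] by auto
qed

lemma relabelled_edges:
  "finite (map_prod s s ` m)" "inj_on snd (map_prod s s ` m)" "card (map_prod s s ` m) = n"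
  "\<And>e. e \<in> map_prod s s ` m \<Longrightarrow> snd e < 2 * n + 2"
proof -
  note M = matchingsD[OF m]
  show "finite (map_prod s s ` m)" using M(1) by simp
  show "inj_on snd (map_prod s s ` m)"
    using inj_on_snd_map_prod_strict_mono[OF strict_mono_relabelling M(3)] .
  show "card (map_prod s s ` m) = n"
    using M(2) card_image[OF inj_on_subset[OF inj_map_prod_strict_mono[OF strict_mono_relabelling] subset_UNIV]]
    by simp
  show "snd e < 2 * n + 2" if "e \<in> map_prod s s ` m" for e using relabelled_edge_bounds[OF that] by simp
qed

lemma add_edge_matchings: "add_edge a m \<in> matchings (Suc n)"
proof -
  note M = matchingsD[OF m]
  have s: "s v \<noteq> p + 1" "s v = s w \<longleftrightarrow> v = w" for v w
    using strict_mono_eq[OF strict_mono_relabelling] opener_space_le by (auto simp: s_def shift_def)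
  have "(p + 1, 2 * n + 2) \<notin> map_prod s s ` m" using relabelled_edges(4) by force
  then have c: "card (add_edge a m) = Suc n"
    using relabelled_edges by (simp add: add_edge_eq)
  have new: "fst e \<noteq> p + 1" "snd e \<noteq> p + 1" if "e \<in> map_prod s s ` m" for e
    using that s(1) by auto
  have "inj_on fst (map_prod s s ` m)"
    using M(4) s(2) by (auto simp: inj_on_def)
  moreover have "p + 1 \<notin> fst ` map_prod s s ` m" using new(1) by (metis imageE)
  ultimately have inj_fst: "inj_on fst (add_edge a m)"
    unfolding add_edge_eq inj_on_insert by auto
  have old: "fst e \<noteq> snd f" if ef: "e \<in> map_prod s s ` m" "f \<in> map_prod s s ` m" for e f
  proof -
    obtain e' f' where "e' \<in> m" "f' \<in> m" "e = map_prod s s e'" "f = map_prod s s f'"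
      using ef by (elim imageE)
    then show ?thesis using M(6)[of e' f'] s(2) by simp
  qed
  show ?thesis
  proof (rule matchingsI[OF c _ inj_fst])
    show "inj_on snd (add_edge a m)"
      unfolding add_edge_eq using relabelled_edges(2,4) by (intro inj_on_snd_insert)
    show "1 \<le> fst e \<and> fst e < snd e \<and> snd e \<le> 2 * Suc n" if "e \<in> add_edge a m" for e
      using that[unfolded add_edge_eq insert_iff] opener_space_le
      by (elim disjE) (simp, drule relabelled_edge_bounds, simp)
    show "fst e \<noteq> snd f" if ef: "e \<in> add_edge a m" "f \<in> add_edge a m" for e f
    proof (cases "f = (p + 1, 2 * n + 2)")
      case True
      then show ?thesis
        using ef(1)[unfolded add_edge_eq insert_iff] relabelled_edge_bounds[of e] opener_space_le by (elim disjE) simp_all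
    next
      case False
      then have "f \<in> map_prod s s ` m" using ef(2)[unfolded add_edge_eq insert_iff] by simp
      then show ?thesis
        using ef(1)[unfolded add_edge_eq insert_iff] new(2)[of f] old[of e f] by (elim disjE) simp_all
    qed
  qed
qed

lemma nth_edge_add_edge_old:
  "k \<in> {1..n} \<Longrightarrow> nth_edge (add_edge a m) k = map_prod s s (nth_edge m k)"
  using nth_edge_insert_old[OF relabelled_edges(1,2,4)] nth_edge_map_prod strict_mono_relabelling
    relabelled_edges(3) matchingsD[OF m] by (simp add: add_edge_eq)

lemma nth_edge_add_edge_new: "nth_edge (add_edge a m) (Suc n) = (p + 1, 2 * n + 2)"
  using nth_edge_insert_new[OF relabelled_edges(1,2,4)] relabelled_edges(3) by (simp add: add_edge_eq)

lemma lef_add_edge_old: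
  assumes "k \<in> {1..n}"
  shows "lef (add_edge a m) (nth_edge (add_edge a m) k) = lef m (nth_edge m k)"
proof -
  have "map_prod s s (nth_edge m k) \<in> map_prod s s ` m"
    using nth_edge_mem(1) matchingsD[OF m] assms by blast
  then have "fst (map_prod s s (nth_edge m k)) \<le> 2 * n + 2" using relabelled_edge_bounds by fastforce
  then show ?thesis
    unfolding nth_edge_add_edge_old[OF assms] unfolding add_edge_eq
    using lef_insert lef_map_prod[OF strict_mono_relabelling] by metis
qed

lemma lef_add_edge_new: "lef (add_edge a m) (nth_edge (add_edge a m) (Suc n)) = a"
proof -
  have "{f \<in> map_prod s s ` m. snd f < p + 1} = map_prod s s ` {f \<in> m. snd f \<le> p}"
    using opener_space_le by (auto simp: s_def shift_def split: if_splits)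
  then have "lef (map_prod s s ` m) (p + 1, 2 * n + 2) = a"
    using card_closers_before_active_space[OF m a]
      card_image[OF inj_on_subset[OF inj_map_prod_strict_mono[OF strict_mono_relabelling] subset_UNIV]]
    by (simp add: lef_def p_def)
  then show ?thesis
    unfolding nth_edge_add_edge_new unfolding add_edge_eq
    using opener_space_le by (subst lef_insert) auto
qed

lemma restr_add_edge:
  assumes "k \<le> n"
  shows "restr (add_edge a m) k = restr m k"
proof -
  have "nth_edge (add_edge a m) ` {1..k} = map_prod s s ` nth_edge m ` {1..k}"
    unfolding image_image using assms nth_edge_add_edge_old by (intro image_cong) auto
  then show ?thesis by (simp add: restr_def standardize_map_prod[OF strict_mono_relabelling])
qed

text \<open>
  The new edge cannot be the outer edge of a left nesting because the vertex after its opener is a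
  closer, nor the inner one because it closes last. Two old openers that are adjacent now were
  already adjacent before.
\<close>

lemma add_edge_no_left_nestings:
  assumes "m \<in> no_left_nestings n"
  shows "add_edge a m \<in> no_left_nestings (Suc n)"
proof -
  note M = matchingsD[OF m]
  have False if nest: "left_nesting (add_edge a m) e f" for e f
  proof -
    have ef: "e \<in> add_edge a m" "f \<in> add_edge a m" "snd f < snd e" "fst f = fst e + 1"
      using nest by (auto simp: left_nesting_def)
    have "snd e \<le> 2 * n + 2" using ef(1) relabelled_edge_bounds by (fastforce simp: add_edge_eq)
    then have f: "f \<in> map_prod s s ` m" using ef(2,3) by (auto simp: add_edge_eq)
    then obtain f' where f': "f' \<in> m" "f = map_prod s s f'" by (elim imageE)
    note bf = M(5)[OF f'(1)]
    show False
    proof (cases "e = (p + 1, 2 * n + 2)")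
      case True
      then have "s (fst f') = p + 2" using ef(4) f' by simp
      then have fp: "fst f' = p + 1" using relabel_old_vertex[of "fst f'"] bf by (auto split: if_splits)
      then have "a < n" using bf M(2) a by (cases "a < n") (auto simp: p_def active_space_def)
      then have cl: "closer m (a + 1) \<in> snd ` m" using closer_mem M by auto
      then have "closer m (a + 1) \<ge> 1" using M(5) by fastforce
      then have "fst f' = closer m (a + 1)"
        using fp \<open>a < n\<close> M(2) by (simp add: p_def active_space_def)
      then show False using cl M(6)[OF f'(1)] by (metis imageE)
    next
      case False
      then obtain e' where e': "e' \<in> m" "e = map_prod s s e'" 
        using ef(1)[unfolded add_edge_eq insert_iff] by (elim disjE imageE) (simp, blast)
      note be = M(5)[OF e'(1)]
      have "fst f' = fst e' + 1"
        using ef(4) e' f' relabel_old_vertex[of "fst e'"] relabel_old_vertex[of "fst f'"] be bf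
        by (auto split: if_splits)
      moreover have "snd f' < snd e'" using ef(3) e' f' strict_mono_less[OF strict_mono_relabelling] by simp
      ultimately have "left_nesting m e' f'" using e' f' bf by (simp add: left_nesting_def)
      then show False using assms unfolding no_left_nestings_def by blast
    qed
  qed
  then show ?thesis using add_edge_matchings by (auto simp: no_left_nestings_def)
qed

end

section \<open>Deleting the edge that closes last\<close>

text \<open>
  This inverts one step of \<open>mh\<close>. With \<open>i\<close> the opener of the last edge, vertex \<open>i + 1\<close> is a closer,
  since otherwise its edge would be left nested in the last one; so \<open>i\<close> was inserted in an active
  space. Deleting \<open>i\<close> makes only \<open>i - 1\<close> and \<open>i + 1\<close> newly adjacent, and a closer \<open>i + 1\<close>
  cannot open the inner edge of a new left nesting.
\<close>

lemma no_left_nestings_SucE: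
  assumes "m' \<in> no_left_nestings (Suc n)"
  obtains m a where "m \<in> no_left_nestings n" "a \<le> n" "m' = add_edge a m"
proof -
  have m': "m' \<in> matchings (Suc n)" and nn: "\<And>e f. \<not> left_nesting m' e f"
    using assms by (auto simp: no_left_nestings_def)
  note M' = matchingsD[OF m']
  have "2 * n + 2 \<in> fst ` m' \<union> snd ` m'" using vertices_matching[OF m'] by auto
  moreover have "2 * n + 2 \<notin> fst ` m'" using M'(5) by fastforce
  ultimately obtain i where last: "(i, 2 * n + 2) \<in> m'" by force
  have i: "1 \<le> i" "i \<le> 2 * n + 1" using M'(5)[OF last] by auto
  define m0 where "m0 = m' - {(i, 2 * n + 2)}"
  \<comment> \<open>The deletion relabels by \<open>g\<close>, and \<open>s\<close> is the relabelling done by the insertion that undoes it.\<close>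
  define g :: "nat \<Rightarrow> nat" where "g v = (if i < v then v - 1 else v)" for v
  define s where "s = shift (i - 1) (2 * n)"
  define m where "m = map_prod g g ` m0"
  have e0: "e \<in> m'" "1 \<le> fst e" "fst e < snd e" "snd e \<le> 2 * n + 1" "fst e \<noteq> i" "snd e \<noteq> i"
    if "e \<in> m0" for e
  proof -
    show e: "e \<in> m'" using that by (simp add: m0_def)
    have ne: "e \<noteq> (i, 2 * n + 2)" using that by (simp add: m0_def)
    show "1 \<le> fst e" "fst e < snd e" using M'(5)[OF e] by auto
    show "fst e \<noteq> i" using inj_onD[OF M'(4) _ e last] ne by auto
    show "snd e \<noteq> i" using M'(6)[OF last e] by auto
    have "snd e \<noteq> 2 * n + 2" using inj_onD[OF M'(3) _ e last] ne by auto
    then show "snd e \<le> 2 * n + 1" using M'(5)[OF e] by auto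
  qed
  have sg: "s (g v) = v" if "v \<noteq> i" "v \<le> 2 * n + 1" for v
    using that i by (auto simp: s_def g_def shift_def)
  have smg: "map_prod s s ` m = m0"
  proof -
    have "map_prod s s (map_prod g g e) = e" if "e \<in> m0" for e
      using e0[OF that] sg[of "fst e"] sg[of "snd e"] by (cases e) auto
    then show ?thesis by (simp add: m_def image_image)
  qed
  have gm: "g v < g w \<longleftrightarrow> v < w" "g v = g w \<longleftrightarrow> v = w" if "v \<noteq> i" "w \<noteq> i" for v w
    using that by (auto simp: g_def)
  have m: "m \<in> matchings n"
  proof (rule matchingsI)
    have "inj_on (map_prod g g) m0"
    proof (rule inj_onI)
      fix e f assume ef: "e \<in> m0" "f \<in> m0" and "map_prod g g e = map_prod g g f"
      then have "g (fst e) = g (fst f)" "g (snd e) = g (snd f)"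
        by (simp_all add: prod_eq_iff)
      then show "e = f" using gm(2) e0(5,6)[OF ef(1)] e0(5,6)[OF ef(2)] by (simp add: prod_eq_iff)
    qed
    then show "card m = n"
      using M'(1,2) last by (simp add: m_def card_image m0_def)
    have src: "\<exists>f\<in>m0. e = map_prod g g f" if "e \<in> m" for e
      using that unfolding m_def image_iff .
    show "inj_on snd m"
    proof (rule inj_onI)
      fix e f assume "e \<in> m" and "f \<in> m" and eq: "snd e = snd f"
      obtain e' f' where ef: "e' \<in> m0" "e = map_prod g g e'" "f' \<in> m0" "f = map_prod g g f'"
        using src[OF \<open>e \<in> m\<close>] src[OF \<open>f \<in> m\<close>] by (elim bexE)
      then have "snd e' = snd f'" using eq gm(2) e0(6) by simp
      then show "e = f" using inj_onD[OF M'(3), of e' f'] e0(1) ef by simp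
    qed
    show "inj_on fst m"
    proof (rule inj_onI)
      fix e f assume "e \<in> m" and "f \<in> m" and eq: "fst e = fst f"
      obtain e' f' where ef: "e' \<in> m0" "e = map_prod g g e'" "f' \<in> m0" "f = map_prod g g f'"
        using src[OF \<open>e \<in> m\<close>] src[OF \<open>f \<in> m\<close>] by (elim bexE)
      then have "fst e' = fst f'" using eq gm(2) e0(5) by simp
      then show "e = f" using inj_onD[OF M'(4), of e' f'] e0(1) ef by simp
    qed
    show "1 \<le> fst e \<and> fst e < snd e \<and> snd e \<le> 2 * n" if e: "e \<in> m" for e
    proof -
      obtain f where f: "f \<in> m0" "e = map_prod g g f" using src[OF e] by (elim bexE)
      show ?thesis using e0[OF f(1)] f(2) i by (auto simp: g_def)
    qed
    show "fst e \<noteq> snd f" if e: "e \<in> m" and f: "f \<in> m" for e f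
    proof -
      obtain e' f' where ef: "e' \<in> m0" "e = map_prod g g e'" "f' \<in> m0" "f = map_prod g g f'"
        using src[OF e] src[OF f] by (elim bexE)
      then show ?thesis
        using M'(6)[OF e0(1)[OF ef(1)] e0(1)[OF ef(3)]] gm(2) e0(5)[OF ef(1)] e0(6)[OF ef(3)] by simp
    qed
  qed
  note M = matchingsD[OF m]
  \<comment> \<open>After the deletion, the old vertex \<open>i + 1\<close> is called \<open>i\<close>. If \<open>i = 2 * n + 1\<close>, then \<open>i + 1\<close>
    is the closer of the last edge and is deleted as well.\<close>
  have cl: "i \<in> snd ` m" if "i \<noteq> 2 * n + 1"
  proof -
    have "i + 1 \<in> fst ` m' \<union> snd ` m'" using vertices_matching[OF m'] i that by auto
    moreover have "i + 1 \<notin> fst ` m'"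
    proof
      assume "i + 1 \<in> fst ` m'"
      then obtain l where l: "(i + 1, l) \<in> m'" by force
      then have "(i + 1, l) \<in> m0" by (simp add: m0_def)
      then have "left_nesting m' (i, 2 * n + 2) (i + 1, l)"
        using e0[of "(i + 1, l)"] last l by (auto simp: left_nesting_def)
      then show False using nn by blast
    qed
    ultimately obtain x where x: "(x, i + 1) \<in> m'" by force
    then have "(x, i + 1) \<in> m0" using that i by (auto simp: m0_def)
    then have "map_prod g g (x, i + 1) \<in> m" unfolding m_def by (rule imageI)
    then show ?thesis by (force simp: g_def)
  qed
  have "\<exists>a\<le>n. active_space m a = i - 1"
  proof (cases "i = 2 * n + 1")
    case True
    then show ?thesis using M(2) by (intro exI[of _ n]) (simp add: active_space_def)
  next
    case False
    then have "i \<in> set (sorted_list_of_set (snd ` m))" using cl M(1) by simp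
    then obtain a where "a < length (sorted_list_of_set (snd ` m))"
        "sorted_list_of_set (snd ` m) ! a = i"
      by (auto simp: in_set_conv_nth)
    then have "a < n" "closer m (a + 1) = i" using M by (simp_all add: closer_def card_image)
    then show ?thesis using M(2) by (intro exI[of _ a]) (simp add: active_space_def)
  qed
  then obtain a where a: "a \<le> n" "active_space m a = i - 1" by blast
  have "m' = insert (i, 2 * n + 2) m0" using last by (auto simp: m0_def)
  then have eq: "m' = add_edge a m"
    using a i M(2) smg by (simp add: add_edge_shift s_def)
  have False if nest: "left_nesting m e f" for e f
  proof -
    have ef: "e \<in> m" "f \<in> m" "snd f < snd e" "fst f = fst e + 1"
      using nest by (auto simp: left_nesting_def)
    note be = M(5)[OF ef(1)] and bf = M(5)[OF ef(2)]
    have "fst f \<noteq> i"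
    proof
      assume fi: "fst f = i"
      then have "i \<in> snd ` m" using bf by (intro cl) auto
      then show False using M(6)[OF ef(2)] fi by (metis imageE)
    qed
    then have "s (fst f) = s (fst e) + 1" using ef(4) be bf by (auto simp: s_def shift_def)
    moreover have sm: "strict_mono s" by (simp add: s_def strict_mono_shift)
    moreover have "map_prod s s e \<in> m'" "map_prod s s f \<in> m'"
      using ef(1,2) smg e0(1) by blast+
    ultimately have "left_nesting m' (map_prod s s e) (map_prod s s f)"
      using ef(3) bf strict_monoD[OF sm, of "fst f" "snd f"] strict_monoD[OF sm, of "snd f" "snd e"]
      by (simp add: left_nesting_def)
    then show False using nn by blast
  qed
  then have "m \<in> no_left_nestings n" using m by (auto simp: no_left_nestings_def)
  then show thesis using that a(1) eq by blast
qed

section \<open>The map on inversion sequences\<close>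

lemma inversion_seqs_snoc:
  "\<alpha> @ [a] \<in> inversion_seqs (Suc n) \<longleftrightarrow> \<alpha> \<in> inversion_seqs n \<and> a \<le> n"
proof -
  have "(\<alpha> @ [a]) ! (k - 1) = \<alpha> ! (k - 1)" if "k \<in> {1..n}" "length \<alpha> = n" for k
    using that by (auto simp: nth_append)
  then show ?thesis
    by (auto simp: inversion_seqs_def atLeastAtMostSuc_conv)
qed

lemma inversion_seqs_take:
  "\<alpha> \<in> inversion_seqs n \<Longrightarrow> k \<le> n \<Longrightarrow> take k \<alpha> \<in> inversion_seqs k"
  by (auto simp: inversion_seqs_def)

lemma mh_step_append: "k \<le> length \<alpha> \<Longrightarrow> mh_step (\<alpha> @ \<beta>) k = mh_step \<alpha> k"
  by (induction k) (simp_all add: Let_def nth_append)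

lemma mh_snoc:
  assumes "card (mh \<alpha>) = length \<alpha>"
  shows "mh (\<alpha> @ [a]) = add_edge a (mh \<alpha>)"
  using assms by (simp add: mh_def add_edge_def mh_step_append Let_def)

lemma mh_no_left_nestings:
  "\<alpha> \<in> inversion_seqs n \<Longrightarrow> mh \<alpha> \<in> no_left_nestings n"
proof (induction \<alpha> arbitrary: n rule: rev_induct)
  case Nil
  then show ?case
    by (auto simp: inversion_seqs_def mh_def no_left_nestings_def matchings_def left_nesting_def)
next
  case (snoc a \<alpha>)
  then have n: "n = Suc (length \<alpha>)" by (auto simp: inversion_seqs_def)
  have a: "\<alpha> \<in> inversion_seqs (length \<alpha>)" "a \<le> length \<alpha>"
    using snoc.prems inversion_seqs_snoc n by auto
  note IH = snoc.IH[OF a(1)]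
  then have m: "mh \<alpha> \<in> matchings (length \<alpha>)" by (simp add: no_left_nestings_def)
  show ?case
    using add_edge_no_left_nestings[OF m a(2) refl refl IH] mh_snoc matchingsD(2)[OF m] n by simp
qed

lemma mh_matchings: "\<alpha> \<in> inversion_seqs n \<Longrightarrow> mh \<alpha> \<in> matchings n"
  using mh_no_left_nestings by (auto simp: no_left_nestings_def)

lemma mh_snoc_inversion_seqs:
  "\<alpha> \<in> inversion_seqs n \<Longrightarrow> mh (\<alpha> @ [a]) = add_edge a (mh \<alpha>)"
  using mh_snoc mh_matchings matchingsD(2) by (auto simp: inversion_seqs_def)

lemma lef_nth_edge_mh:
  "\<alpha> \<in> inversion_seqs n \<Longrightarrow> k < n \<Longrightarrow> lef (mh \<alpha>) (nth_edge (mh \<alpha>) (Suc k)) = \<alpha> ! k"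
proof (induction \<alpha> arbitrary: n rule: rev_induct)
  case Nil
  then show ?case by (simp add: inversion_seqs_def)
next
  case (snoc a \<alpha>)
  then have n: "n = Suc (length \<alpha>)" by (auto simp: inversion_seqs_def)
  have a: "\<alpha> \<in> inversion_seqs (length \<alpha>)" "a \<le> length \<alpha>"
    using snoc.prems inversion_seqs_snoc n by auto
  note m = mh_matchings[OF a(1)]
  show ?case
  proof (cases "k < length \<alpha>")
    case True
    then show ?thesis
      using lef_add_edge_old[OF m a(2) refl refl, of "Suc k"] snoc.IH[OF a(1) True]
        mh_snoc_inversion_seqs[OF a(1)] by (simp add: nth_append)
  next
    case False
    then have "k = length \<alpha>" using snoc.prems n by simp
    then show ?thesis
      using lef_add_edge_new[OF m a(2) refl refl] mh_snoc_inversion_seqs[OF a(1)] by simp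
  qed
qed

lemma restr_mh:
  "\<alpha> \<in> inversion_seqs n \<Longrightarrow> k \<le> n \<Longrightarrow> restr (mh \<alpha>) k = mh (take k \<alpha>)"
proof (induction \<alpha> arbitrary: n rule: rev_induct)
  case Nil
  then show ?case
    by (auto simp: inversion_seqs_def mh_def restr_def standardize_def)
next
  case (snoc a \<alpha>)
  then have n: "n = Suc (length \<alpha>)" by (auto simp: inversion_seqs_def)
  have a: "\<alpha> \<in> inversion_seqs (length \<alpha>)" "a \<le> length \<alpha>"
    using snoc.prems inversion_seqs_snoc n by auto
  note m = mh_matchings[OF a(1)]
  show ?case
  proof (cases "k \<le> length \<alpha>")
    case True
    then show ?thesis
      using restr_add_edge[OF m a(2) refl refl True] snoc.IH[OF a(1) True]
        mh_snoc_inversion_seqs[OF a(1)] by simp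
  next
    case False
    then have "k = n" using snoc.prems n by simp
    then show ?thesis
      using restr_all[OF mh_matchings[OF snoc.prems(1)]] n by simp
  qed
qed

lemma ddis_mh:
  assumes "\<alpha> \<in> inversion_seqs n"
  shows "ddis d (mh \<alpha>) = dasc d \<alpha>"
proof -
  have "lef (mh \<alpha>) (nth_edge (mh \<alpha>) (k + 1)) = \<alpha> ! k" "lef (mh \<alpha>) (nth_edge (mh \<alpha>) k) = \<alpha> ! (k - 1)"
    if "k \<in> {1..<n}" for k
    using lef_nth_edge_mh[OF assms, of k] lef_nth_edge_mh[OF assms, of "k - 1"] that by auto
  moreover have "card (mh \<alpha>) = n" "length \<alpha> = n"
    using matchingsD(2)[OF mh_matchings[OF assms]] assms by (auto simp: inversion_seqs_def)
  ultimately show ?thesis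
    unfolding ddis_def dasc_def by (intro arg_cong[of _ _ card]) auto
qed

lemma inj_on_mh: "inj_on mh (inversion_seqs n)"
proof (rule inj_onI)
  fix \<alpha> \<beta> assume s: "\<alpha> \<in> inversion_seqs n" "\<beta> \<in> inversion_seqs n" and eq: "mh \<alpha> = mh \<beta>"
  show "\<alpha> = \<beta>"
  proof (rule nth_equalityI)
    show "length \<alpha> = length \<beta>" using s by (simp add: inversion_seqs_def)
    show "\<alpha> ! k = \<beta> ! k" if "k < length \<alpha>" for k
      using lef_nth_edge_mh[OF s(1)] lef_nth_edge_mh[OF s(2)] eq that s(1)
      by (simp add: inversion_seqs_def)
  qed
qed

lemma no_left_nestings_subset_image_mh: "no_left_nestings n \<subseteq> mh ` inversion_seqs n"
proof (induction n)
  case 0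
  have "m = {}" if "m \<in> no_left_nestings 0" for m
    using that matchingsD(1,2)[of m 0] by (auto simp: no_left_nestings_def)
  moreover have "mh [] = {}" "[] \<in> inversion_seqs 0" by (auto simp: mh_def inversion_seqs_def)
  ultimately show ?case by (metis image_eqI subsetI)
next
  case (Suc n)
  show ?case
  proof
    fix m' assume "m' \<in> no_left_nestings (Suc n)"
    then obtain m a where m: "m \<in> no_left_nestings n" "a \<le> n" "m' = add_edge a m"
      by (rule no_left_nestings_SucE)
    then obtain \<alpha> where \<alpha>: "\<alpha> \<in> inversion_seqs n" "m = mh \<alpha>" using Suc by blast
    then have "m' = mh (\<alpha> @ [a])" using m mh_snoc_inversion_seqs by simp
    then show "m' \<in> mh ` inversion_seqs (Suc n)"
      using inversion_seqs_snoc \<alpha> m by blast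
  qed
qed

lemma mh_mem_dMch_iff:
  assumes "\<alpha> \<in> inversion_seqs n"
  shows "mh \<alpha> \<in> dMch d n \<longleftrightarrow> \<alpha> \<in> dA d n"
proof -
  have "lef (mh \<alpha>) (nth_edge (mh \<alpha>) (k + 1)) = \<alpha> ! k"
    "ddis d (restr (mh \<alpha>) k) = dasc d (take k \<alpha>)" if "k \<in> {1..<n}" for k
    using lef_nth_edge_mh[OF assms, of k] restr_mh[OF assms, of k] that
      ddis_mh[OF inversion_seqs_take[OF assms, of k]] by auto
  moreover have "length \<alpha> = n" using assms by (simp add: inversion_seqs_def)
  moreover have "\<alpha> ! 0 = 0" if "n > 0"
  proof -
    have "\<forall>k\<in>{1..n}. \<alpha> ! (k - 1) < k" using assms by (simp add: inversion_seqs_def)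
    from bspec[OF this, of 1] show ?thesis using that by simp
  qed
  ultimately show ?thesis
    using mh_no_left_nestings[OF assms] by (auto simp: dMch_def dA_def)
qed

theorem theorem3p2:
  fixes d n :: nat
  shows "bij_betw mh (dA d n) (dMch d n)"
proof (rule bij_betw_imageI)
  show "inj_on mh (dA d n)"
    using inj_on_mh dA_subset_inversion_seqs by (rule inj_on_subset)
  have "dMch d n \<subseteq> mh ` inversion_seqs n"
    using no_left_nestings_subset_image_mh by (auto simp: dMch_def)
  then show "mh ` dA d n = dMch d n"
    using mh_mem_dMch_iff[of _ n d] dA_subset_inversion_seqs[of d n] by auto
qed

end
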